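(* Let $\Gamma$ be a connected finite simple graph, let $e=\{v,w\}$ be a cycle-edge of $\Gamma$, and let $\Gamma'$ and $\Gamma''$ be the graphs obtained from $\Gamma$ by deleting and by contracting $e$, respectively. Then the map $$\Theta\colon \mathrm{Acyc}(\Gamma)/\!\sim_\kappa\;\longrightarrow\;\bigl(\mathrm{Acyc}(\Gamma')/\!\sim_\kappa\bigr)\,\cup\,\bigl(\mathrm{Acyc}(\Gamma'')/\!\sim_\kappa\bigr)$$ (the union being disjoint) given by $$\Theta([O_\Gamma])=\begin{cases}[O^\pi_{\Gamma''}], & \text{if there exists } O^\pi_\Gamma\in[O_\Gamma] \text{ with } \pi=vw\pi_3\cdots\pi_n,\\ [O^\pi_{\Gamma'}], & \text{otherwise,}\end{cases}$$ where $O^\pi_\Gamma$ denotes an orientation in $[O_\Gamma]$ such that $\pi=v\pi_2\cdots\pi_n$ and $w=\pi_i$ with $i$ minimal, is a bijection.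
   Context: $\Gamma$ has vertex set $\mathrm{v}[\Gamma]=\{1,\dots,n\}$. A cycle-edge is an edge that is not a bridge, i.e. whose removal does not increase the number of connected components. $\mathrm{Acyc}(\Gamma)$ is the set of acyclic orientations of $\Gamma$. A click (source-to-sink operation) takes a vertex that is a source of an acyclic orientation and reverses all edges at it, so that it becomes a sink. Two acyclic orientations of the same graph are $\kappa$-equivalent, written $\sim_\kappa$, if one can be transformed into the other by a finite sequence of clicks; this is an equivalence relation, and $[O]$ denotes the equivalence class ($\kappa$-class) of $O$. The relation is defined in the same way on $\mathrm{Acyc}(\Gamma')$ and $\mathrm{Acyc}(\Gamma'')$. For a total order (permutation) $\pi=\pi_1\pi_2\cdots\pi_n$ of $\mathrm{v}[\Gamma]$, $O^\pi_\Gamma$ is the acyclic orientation of $\Gamma$ in which each edge $\{i,j\}$ is oriented from $i$ to $j$ iff $i$ precedes $j$ in $\pi$. Every acyclic orientation is of this form. All graphs are simple and loop-free: in the contraction $\Gamma''$, the endpoints $v,w$ become a single vertex, the resulting loop is removed, and parallel edges are regarded as a single edge. $O^\pi_{\Gamma'}$ is the orientation of $\Gamma'$ inherited from $O^\pi_\Gamma$ (restriction to the remaining edges). When $\pi=vw\pi_3\cdots\pi_n$, $O^\pi_{\Gamma''}$ is the acyclic orientation of $\Gamma''$ inherited from $O^\pi_\Gamma$, i.e. the one induced by the order $V\pi_3\cdots\pi_n$, where $V$ is the contracted vertex. In the definition of $\Theta$, "$i$ minimal" means minimal among all permutations $\pi$ with $\pi_1=v$ and $O^\pi_\Gamma\in[O_\Gamma]$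 (such $\pi$ always exist); the value of $\Theta$ does not depend on the choice of such $\pi$. *)

theory Defs
  imports Main "HOL-Combinatorics.Multiset_Permutations"
begin

record 'a graph =
  verts :: "'a set"
  edges :: "'a set set"

definition simple_graph :: "'a graph \<Rightarrow> bool" where
  "simple_graph G \<longleftrightarrow> finite (verts G) \<and> (\<forall>e\<in>edges G. e \<subseteq> verts G \<and> card e = 2)"

definition adjacency :: "'a graph \<Rightarrow> ('a \<times> 'a) set" where
  "adjacency G = {(x, y). {x, y} \<in> edges G}"

definition components :: "'a graph \<Rightarrow> 'a set set" where
  "components G = verts G // {(x, y). x \<in> verts G \<and> y \<in> verts G \<and> (x, y) \<in> (adjacency G)\<^sup>*}"

definition connected_graph :: "'a graph \<Rightarrow> bool" where
  "connected_graph G \<longleftrightarrow>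
     verts G \<noteq> {} \<and> (\<forall>x\<in>verts G. \<forall>y\<in>verts G. (x, y) \<in> (adjacency G)\<^sup>*)"

definition delete_edge :: "'a graph \<Rightarrow> 'a set \<Rightarrow> 'a graph" where
  "delete_edge G e = \<lparr>verts = verts G, edges = edges G - {e}\<rparr>"

(* The contracted vertex is represented by v; the vertex w disappears. Edges being sets,
   parallel edges are merged, and the loop arising from {v, w} is the singleton {v}. *)
definition contract_edge :: "'a graph \<Rightarrow> 'a \<Rightarrow> 'a \<Rightarrow> 'a graph" where
  "contract_edge G v w =
     \<lparr>verts = verts G - {w},
      edges = (\<lambda>f. (\<lambda>x. if x = w then v else x) ` f) ` edges G - {{v}}\<rparr>"

definition bridge :: "'a graph \<Rightarrow> 'a set \<Rightarrow> bool" where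
  "bridge G e \<longleftrightarrow> e \<in> edges G \<and> card (components G) < card (components (delete_edge G e))"

definition cycle_edge :: "'a graph \<Rightarrow> 'a set \<Rightarrow> bool" where
  "cycle_edge G e \<longleftrightarrow> e \<in> edges G \<and> \<not> bridge G e"

(* An orientation is a set of arcs; (x, y) is the arc from x to y. *)
definition orientation :: "'a graph \<Rightarrow> ('a \<times> 'a) set \<Rightarrow> bool" where
  "orientation G A \<longleftrightarrow>
     A \<subseteq> adjacency G \<and> (\<forall>x y. {x, y} \<in> edges G \<longrightarrow> ((x, y) \<in> A) \<noteq> ((y, x) \<in> A))"

definition Acyc :: "'a graph \<Rightarrow> ('a \<times> 'a) set set" where
  "Acyc G = {A. orientation G A \<and> acyclic A}"

definition source :: "'a graph \<Rightarrow> ('a \<times> 'a) set \<Rightarrow> 'a \<Rightarrow> bool" where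
  "source G A x \<longleftrightarrow> x \<in> verts G \<and> (\<forall>y. (y, x) \<notin> A)"

definition reverse_at :: "'a \<Rightarrow> ('a \<times> 'a) set \<Rightarrow> ('a \<times> 'a) set" where
  "reverse_at x A = {(a, b). if a = x \<or> b = x then (b, a) \<in> A else (a, b) \<in> A}"

definition click :: "'a graph \<Rightarrow> (('a \<times> 'a) set \<times> ('a \<times> 'a) set) set" where
  "click G = {(A, reverse_at x A) | A x. A \<in> Acyc G \<and> source G A x}"

definition kappa :: "'a graph \<Rightarrow> (('a \<times> 'a) set \<times> ('a \<times> 'a) set) set" where
  "kappa G = {(A, B). A \<in> Acyc G \<and> B \<in> Acyc G \<and> (A, B) \<in> (click G)\<^sup>*}"

definition kappa_class :: "'a graph \<Rightarrow> ('a \<times> 'a) set \<Rightarrow> ('a \<times> 'a) set set" where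
  "kappa_class G A = kappa G `` {A}"

(* Positions are counted from 0. *)
definition position :: "'a list \<Rightarrow> 'a \<Rightarrow> nat" where
  "position p x = (LEAST i. i < length p \<and> p ! i = x)"

definition orient :: "'a graph \<Rightarrow> 'a list \<Rightarrow> ('a \<times> 'a) set" where
  "orient G p = {(x, y). {x, y} \<in> edges G \<and> position p x < position p y}"

definition starts_vw :: "'a graph \<Rightarrow> 'a \<Rightarrow> 'a \<Rightarrow> ('a \<times> 'a) set set \<Rightarrow> bool" where
  "starts_vw G v w C \<longleftrightarrow>
     (\<exists>r. v # w # r \<in> permutations_of_set (verts G) \<and> orient G (v # w # r) \<in> C)"

definition admissible :: "'a graph \<Rightarrow> 'a \<Rightarrow> 'a \<Rightarrow> ('a \<times> 'a) set set \<Rightarrow> 'a list \<Rightarrow> bool" where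
  "admissible G v w C =
     is_arg_min (\<lambda>p. position p w)
       (\<lambda>p. p \<in> permutations_of_set (verts G) \<and> hd p = v \<and> orient G p \<in> C)"

(* Inl and Inr tag the classes of the deletion and of the contraction. If starts_vw holds, an
   admissible order has the form p = v # w # r, and v # drop 2 p = v # r is the induced order on
   the contraction. *)
definition Theta_value ::
  "'a graph \<Rightarrow> 'a \<Rightarrow> 'a \<Rightarrow> ('a \<times> 'a) set set \<Rightarrow> 'a list \<Rightarrow> ('a \<times> 'a) set set + ('a \<times> 'a) set set"
where
  "Theta_value G v w C p =
     (if starts_vw G v w C
      then Inr (kappa_class (contract_edge G v w) (orient (contract_edge G v w) (v # drop 2 p)))
      else Inl (kappa_class (delete_edge G {v, w}) (orient (delete_edge G {v, w}) p)))"

definition Theta ::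
  "'a graph \<Rightarrow> 'a \<Rightarrow> 'a \<Rightarrow> ('a \<times> 'a) set set \<Rightarrow> ('a \<times> 'a) set set + ('a \<times> 'a) set set"
where
  "Theta G v w C = Theta_value G v w C (SOME p. admissible G v w C p)"

end

theory Submission
  imports Defs
begin

text \<open>
  Acyclic orientations \<open>A\<close> and \<open>B\<close> are click-equivalent iff \<open>B - A\<close>, viewed as a function on ordered
  pairs of adjacent vertices, is the gradient of an integer potential, which counts clicks. A
  vertex minimizing the potential can be chosen to be a source of \<open>B\<close>; hence every class contains
  exactly one orientation whose unique source is \<open>v\<close>. If such an orientation has a further arc into
  \<open>w\<close>, deleting \<open>(v, w)\<close> leaves \<open>v\<close> the unique source; otherwise contracting \<open>(v, w)\<close> does, and
  both operations are invertible. Finally, any two equivalent orientations containing \<open>(v, w)\<close>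
  have a potential with equal values at \<open>v\<close> and \<open>w\<close>, which therefore descends to the deletion and
  the contraction. So the classes in the definition of \<open>\<Theta>\<close> may be computed from the orientation
  with unique source \<open>v\<close>.
\<close>

section \<open>Graphs and acyclic orientations\<close>

lemma edge_endpoints:
  assumes "simple_graph G" "{x, y} \<in> edges G"
  shows "x \<in> verts G" "y \<in> verts G" "x \<noteq> y"
proof -
  have "{x, y} \<subseteq> verts G" "card {x, y} = 2"
    using assms unfolding simple_graph_def by auto
  then show "x \<in> verts G" "y \<in> verts G" "x \<noteq> y"
    by auto
qed

lemma orientation_edge: "orientation G A \<Longrightarrow> (x, y) \<in> A \<Longrightarrow> {x, y} \<in> edges G"
  unfolding orientation_def adjacency_def by auto

lemma orientation_flip:
  "orientation G A \<Longrightarrow> {x, y} \<in> edges G \<Longrightarrow> (x, y) \<in> A \<longleftrightarrow> (y, x) \<notin> A"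
  unfolding orientation_def by blast

text \<open>\<open>A\<close> contains some direction of each edge, and \<open>B\<close> cannot
  contain both, so no arc of \<open>B\<close> is missing from \<open>A\<close>.\<close>

lemma orientation_subset_eq:
  assumes "orientation G B" "A \<subseteq> B"
    and "\<And>x y. {x, y} \<in> edges G \<Longrightarrow> (x, y) \<in> A \<or> (y, x) \<in> A"
  shows "A = B"
proof
  show "B \<subseteq> A"
  proof (rule subrelI)
    fix x y assume "(x, y) \<in> B"
    then show "(x, y) \<in> A"
      using assms(2,3) orientation_edge[OF assms(1)] orientation_flip[OF assms(1)] by blast
  qed
qed (rule assms(2))

lemma Acyc_orientation: "A \<in> Acyc G \<Longrightarrow> orientation G A"
  unfolding Acyc_def by blast

text \<open>Well-foundedness lets one pick, in any nonempty set of vertices, a vertex with no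
  incoming arc from that set.\<close>

lemma Acyc_wf:
  assumes "simple_graph G" "A \<in> Acyc G"
  shows "wf A"
proof (rule finite_acyclic_wf)
  have "A \<subseteq> verts G \<times> verts G"
    using orientation_edge[OF Acyc_orientation[OF assms(2)]] edge_endpoints[OF assms(1)]
    by (meson SigmaI subrelI)
  moreover have "finite (verts G)"
    using assms(1) unfolding simple_graph_def by blast
  ultimately show "finite A"
    by (meson finite_SigmaI finite_subset)
  show "acyclic A"
    using assms(2) unfolding Acyc_def by blast
qed

section \<open>Orientations induced by vertex orders\<close>

lemma position_Cons:
  assumes "y \<in> set (x # p)"
  shows "position (x # p) y = (if y = x then 0 else Suc (position p y))"
proof (cases "y = x")
  case True
  then show ?thesis unfolding position_def by (auto intro: Least_equality)
next
  case False
  then obtain i where "i < length p" "p ! i = y"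
    using assms by (auto simp: in_set_conv_nth)
  then have "Suc i < length (x # p) \<and> (x # p) ! Suc i = y" by simp
  then have "(LEAST i. i < length (x # p) \<and> (x # p) ! i = y) =
      Suc (LEAST i. Suc i < length (x # p) \<and> (x # p) ! Suc i = y)"
    by (rule Least_Suc) (use False in auto)
  then show ?thesis using False unfolding position_def by simp
qed

lemma nth_position:
  assumes "y \<in> set p"
  shows "position p y < length p" "p ! position p y = y"
proof -
  obtain i where "i < length p \<and> p ! i = y"
    using assms by (auto simp: in_set_conv_nth)
  then have "position p y < length p \<and> p ! position p y = y"
    unfolding position_def by (rule LeastI)
  then show "position p y < length p" "p ! position p y = y" by auto
qed

text \<open>Adjacent vertices have distinct positions, and positions strictly increase along arcs,
  which rules out cycles.\<close>

lemma orient_Acyc: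
  assumes "simple_graph G" "p \<in> permutations_of_set (verts G)"
  shows "orient G p \<in> Acyc G"
proof -
  have p: "set p = verts G"
    using assms(2) by (simp add: permutations_of_set_def)
  have "position p x \<noteq> position p y" if "{x, y} \<in> edges G" for x y
    using edge_endpoints[OF assms(1) that] nth_position[of x p] nth_position[of y p] p by metis
  then have "orientation G (orient G p)"
    unfolding orientation_def orient_def adjacency_def
    by (auto simp: insert_commute nat_neq_iff)
  moreover have "acyclic (orient G p)"
    by (rule wf_acyclic, rule wf_subset[OF wf_measure[of "position p"]])
      (auto simp: orient_def)
  ultimately show ?thesis unfolding Acyc_def by blast
qed

text \<open>A linear extension of \<open>A\<close> on \<open>V\<close>. Arcs with an endpoint
  outside \<open>V\<close> are ignored, so that vertices can be removed one at a time.\<close>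

definition topological :: "('a \<times> 'a) set \<Rightarrow> 'a set \<Rightarrow> 'a list \<Rightarrow> bool" where
  "topological A V p \<longleftrightarrow> p \<in> permutations_of_set V \<and>
     (\<forall>x\<in>V. \<forall>y\<in>V. (x, y) \<in> A \<longrightarrow> position p x < position p y)"

lemma topological_Cons:
  assumes "topological A (V - {s}) p" "s \<in> V" "\<And>y. y \<in> V \<Longrightarrow> (y, s) \<notin> A"
  shows "topological A V (s # p)"
proof -
  have p: "set p = V - {s}" "distinct p"
    using assms(1) by (auto simp: topological_def permutations_of_set_def)
  have "position (s # p) x < position (s # p) y" if "x \<in> V" "y \<in> V" "(x, y) \<in> A" for x y
  proof -
    have "y \<noteq> s" using assms(3) that by blast
    then show ?thesis
      using assms(1) that p by (auto simp: position_Cons topological_def)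
  qed
  then show ?thesis
    using p assms(2) by (auto simp: topological_def permutations_of_set_def)
qed

lemma topological_exists:
  assumes "finite V" "wf A"
  shows "\<exists>p. topological A V p"
  using assms(1)
proof (induction V rule: finite_psubset_induct)
  case (psubset V)
  show ?case
  proof (cases "V = {}")
    case True
    then show ?thesis by (simp add: topological_def)
  next
    case False
    then obtain s where s: "s \<in> V" "\<And>y. (y, s) \<in> A \<Longrightarrow> y \<notin> V"
      using wfE_min[OF assms(2)] by (metis ex_in_conv)
    then have "V - {s} \<subset> V" by blast
    then obtain p where "topological A (V - {s}) p" using psubset.IH by blast
    then have "topological A V (s # p)" by (rule topological_Cons) (use s in blast)+
    then show ?thesis by blast
  qed
qed

text \<open>A linear extension respects every arc of \<open>A\<close>, so \<open>A\<close> lies in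
  the induced orientation; between orientations of one graph, inclusion is equality.\<close>

lemma orient_eqI:
  assumes "simple_graph G" "A \<in> Acyc G" "topological A (verts G) p"
  shows "orient G p = A"
proof -
  have o: "orientation G A" using assms(2) by (rule Acyc_orientation)
  have "A = orient G p"
  proof (rule orientation_subset_eq)
    show "orientation G (orient G p)"
      using orient_Acyc[OF assms(1)] assms(3) Acyc_orientation unfolding topological_def by blast
    show "A \<subseteq> orient G p"
      using assms(3) orientation_edge[OF o] edge_endpoints[OF assms(1)]
      unfolding orient_def topological_def by fastforce
    show "(x, y) \<in> A \<or> (y, x) \<in> A" if "{x, y} \<in> edges G" for x y
      using orientation_flip[OF o that] by blast
  qed
  then show ?thesis ..
qed

lemma orient_source_first:
  assumes "simple_graph G" "A \<in> Acyc G" "source G A v"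
  obtains r where "v # r \<in> permutations_of_set (verts G)" "orient G (v # r) = A"
proof -
  have "finite (verts G - {v})" using assms(1) unfolding simple_graph_def by blast
  then obtain r where "topological A (verts G - {v}) r"
    using topological_exists Acyc_wf[OF assms(1,2)] by blast
  then have "topological A (verts G) (v # r)"
    by (rule topological_Cons) (use assms(3) in \<open>auto simp: source_def\<close>)
  then show ?thesis
    using that orient_eqI[OF assms(1,2)] unfolding topological_def by blast
qed

text \<open>Once \<open>v\<close> is removed, \<open>w\<close> has no incoming arc and may come
  next. This produces the orders on which contraction operates.\<close>

lemma orient_sources_first:
  assumes "simple_graph G" "A \<in> Acyc G" "source G A v"
    and "w \<in> verts G" "w \<noteq> v" "\<And>x. (x, w) \<in> A \<Longrightarrow> x = v"
  obtains r where "v # w # r \<in> permutations_of_set (verts G)" "orient G (v # w # r) = A"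
proof -
  have "finite (verts G - {v} - {w})" using assms(1) unfolding simple_graph_def by blast
  then obtain r where "topological A (verts G - {v} - {w}) r"
    using topological_exists Acyc_wf[OF assms(1,2)] by blast
  then have "topological A (verts G - {v}) (w # r)"
    by (rule topological_Cons) (use assms(4-6) in auto)
  then have "topological A (verts G) (v # w # r)"
    by (rule topological_Cons) (use assms(3) in \<open>auto simp: source_def\<close>)
  then show ?thesis
    using that orient_eqI[OF assms(1,2)] unfolding topological_def by blast
qed

section \<open>Click-equivalence as a gradient\<close>

text \<open>Think of \<open>c x\<close> as the number of clicks at \<open>x\<close> on the way from \<open>A\<close> to \<open>B\<close>.\<close>

definition gradient :: "'a graph \<Rightarrow> ('a \<Rightarrow> int) \<Rightarrow> ('a \<times> 'a) set \<Rightarrow> ('a \<times> 'a) set \<Rightarrow> bool" where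
  "gradient G c A B \<longleftrightarrow> (\<forall>x y. {x, y} \<in> edges G \<longrightarrow>
     of_bool ((x, y) \<in> B) = of_bool ((x, y) \<in> A) + c y - c x)"

lemma gradientD:
  "gradient G c A B \<Longrightarrow> {x, y} \<in> edges G \<Longrightarrow>
    of_bool ((x, y) \<in> B) = of_bool ((x, y) \<in> A) + c y - c x"
  unfolding gradient_def by blast

lemma gradient_refl: "gradient G (\<lambda>x. 0) A A"
  unfolding gradient_def by simp

lemma gradient_sym: "gradient G c A B \<Longrightarrow> gradient G (\<lambda>x. - c x) B A"
  unfolding gradient_def by simp

lemma gradient_trans:
  "gradient G c A B \<Longrightarrow> gradient G d B D \<Longrightarrow> gradient G (\<lambda>x. c x + d x) A D"
  unfolding gradient_def by simp

lemma gradient_const_eq: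
  assumes "simple_graph G" "A \<in> Acyc G" "B \<in> Acyc G" "gradient G c A B"
    and "\<And>x. x \<in> verts G \<Longrightarrow> c x = m"
  shows "A = B"
proof (rule orientation_subset_eq)
  show "orientation G B" using assms(3) by (rule Acyc_orientation)
  show "A \<subseteq> B"
  proof
    fix e assume "e \<in> A"
    obtain x y where e: "e = (x, y)" by fastforce
    have E: "{x, y} \<in> edges G"
      using orientation_edge[OF Acyc_orientation[OF assms(2)]] \<open>e \<in> A\<close> e by blast
    show "e \<in> B"
      using gradientD[OF assms(4) E] assms(5) edge_endpoints[OF assms(1) E] \<open>e \<in> A\<close> e by simp
  qed
  show "(x, y) \<in> A \<or> (y, x) \<in> A" if "{x, y} \<in> edges G" for x y
    using orientation_flip[OF Acyc_orientation[OF assms(2)] that] by blast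
qed

text \<open>Every edge leaving the set of minimizers of \<open>c\<close> is directed outwards in \<open>B\<close>.\<close>

lemma source_at_minimum:
  assumes "simple_graph G" "verts G \<noteq> {}" "B \<in> Acyc G" "gradient G c A B"
  shows "\<exists>x. source G B x \<and> (\<forall>y\<in>verts G. c x \<le> c y)"
proof -
  define M where "M = {x \<in> verts G. \<forall>y\<in>verts G. c x \<le> c y}"
  have fin: "finite (verts G)" using assms(1) unfolding simple_graph_def by blast
  have "Min (c ` verts G) \<in> c ` verts G" using fin assms(2) by simp
  then obtain z where "z \<in> verts G" "c z = Min (c ` verts G)" by force
  then have "z \<in> M" using fin unfolding M_def by simp
  \<comment> \<open>\<open>x\<close> is a \<open>B\<close>-minimal element of \<open>M\<close>, so
    an arc into \<open>x\<close> can only start outside \<open>M\<close>, where \<open>c\<close> is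
    strictly larger; the gradient equation then makes the indicator of that arc at most 0.\<close>
  then obtain x where x: "x \<in> M" "\<And>y. (y, x) \<in> B \<Longrightarrow> y \<notin> M"
    using wfE_min[OF Acyc_wf[OF assms(1,3)]] by metis
  have "(y, x) \<notin> B" for y
  proof
    assume yx: "(y, x) \<in> B"
    have E: "{y, x} \<in> edges G" using orientation_edge[OF Acyc_orientation[OF assms(3)] yx] .
    have y: "y \<in> verts G" using edge_endpoints[OF assms(1) E] by blast
    have "c x < c y"
      using x(1) x(2)[OF yx] y unfolding M_def by (auto simp: not_le intro: less_le_trans le_less_trans)
    then show False using gradientD[OF assms(4) E] yx by (auto simp: of_bool_def split: if_splits)
  qed
  then show ?thesis using x(1) unfolding source_def M_def by blast
qed

section \<open>Clicks and potentials\<close>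

lemma reverse_at_Acyc:
  assumes "simple_graph G" "A \<in> Acyc G" "source G A x"
  shows "reverse_at x A \<in> Acyc G"
proof -
  have o: "orientation G A" using assms(2) by (rule Acyc_orientation)
  have sink: "(x, y) \<notin> reverse_at x A" for y
    using assms(3) unfolding source_def reverse_at_def by auto
  have arc: "(a, b) \<in> A \<or> (b, a) \<in> A" if "(a, b) \<in> reverse_at x A" for a b
    using that by (auto simp: reverse_at_def split: if_splits)
  have "orientation G (reverse_at x A)"
    unfolding orientation_def
  proof (intro conjI allI impI subrelI)
    show "(a, b) \<in> adjacency G" if "(a, b) \<in> reverse_at x A" for a b
      using arc[OF that] orientation_edge[OF o, of a b] orientation_edge[OF o, of b a]
      unfolding adjacency_def by (auto simp: insert_commute)
    show "((a, b) \<in> reverse_at x A) \<noteq> ((b, a) \<in> reverse_at x A)" if "{a, b} \<in> edges G" for a b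
      using orientation_flip[OF o that] by (simp add: reverse_at_def disj_commute)
  qed
  \<comment> \<open>After the click \<open>x\<close> is a sink, so a path ending elsewhere avoids
    \<open>x\<close> and uses only arcs of \<open>A\<close>. A cycle would be such a path.\<close>
  moreover have lift: "(a, b) \<in> (reverse_at x A)\<^sup>+ \<Longrightarrow> b \<noteq> x \<Longrightarrow> (a, b) \<in> A\<^sup>+" for a b
  proof (induction rule: trancl_induct)
    case (base b)
    then show ?case using sink[of b] by (auto simp: reverse_at_def split: if_splits)
  next
    case (step b c)
    then have "b \<noteq> x" using sink by blast
    then have "(b, c) \<in> A" using step by (auto simp: reverse_at_def)
    with step.IH \<open>b \<noteq> x\<close> show ?case by (meson trancl.trancl_into_trancl)
  qed
  have "acyclic (reverse_at x A)"
    unfolding acyclic_def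
  proof (intro allI notI)
    fix a assume a: "(a, a) \<in> (reverse_at x A)\<^sup>+"
    then have "a \<noteq> x" using sink by (blast dest: tranclD)
    then show False
      using lift[OF a] assms(2) unfolding Acyc_def acyclic_def by blast
  qed
  ultimately show ?thesis unfolding Acyc_def by blast
qed

lemma gradient_reverse_at:
  assumes "simple_graph G" "A \<in> Acyc G" "source G A x"
  shows "gradient G (\<lambda>z. of_bool (z = x)) A (reverse_at x A)"
  unfolding gradient_def
proof (intro allI impI)
  fix a b assume E: "{a, b} \<in> edges G"
  have "a \<noteq> b" using edge_endpoints[OF assms(1) E] by blast
  moreover have "(a, b) \<in> A \<longleftrightarrow> (b, a) \<notin> A"
    using orientation_flip[OF Acyc_orientation[OF assms(2)] E] .
  ultimately show "of_bool ((a, b) \<in> reverse_at x A)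
      = of_bool ((a, b) \<in> A) + of_bool (b = x) - (of_bool (a = x) :: int)"
    using assms(3) unfolding source_def reverse_at_def by auto
qed

text \<open>Each click adds the indicator of the clicked vertex, and potentials add up along a
  sequence.\<close>

lemma clicks_gradient:
  assumes "simple_graph G" "(A, B) \<in> (click G)\<^sup>*" "A \<in> Acyc G"
  shows "\<exists>c. gradient G c A B"
  using assms(2)
proof (induction rule: rtrancl_induct)
  case base
  then show ?case using gradient_refl by blast
next
  case (step B D)
  then show ?case
    unfolding click_def using gradient_trans gradient_reverse_at[OF assms(1)] by blast
qed

text \<open>Clicking at a source where the potential is minimal levels the potential, and
  orientations differing by a constant potential agree.\<close>

lemma gradient_clicks:
  assumes "simple_graph G" "A \<in> Acyc G" "B \<in> Acyc G" "gradient G c A B"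
    and "\<And>x. x \<in> verts G \<Longrightarrow> c x \<le> m"
  shows "(B, A) \<in> (click G)\<^sup>*"
  using assms(3-5)
\<comment> \<open>The measure is the number of clicks that raise \<open>c\<close> to the constant
  \<open>m\<close>; at that point \<open>B\<close> has been turned back into
  \<open>A\<close>.\<close>
proof (induction "nat (\<Sum>x\<in>verts G. m - c x)" arbitrary: B c rule: less_induct)
  case less
  have fin: "finite (verts G)" using assms(1) unfolding simple_graph_def by blast
  show ?case
  proof (cases "\<forall>x\<in>verts G. c x = m")
    case True
    then show ?thesis using gradient_const_eq[OF assms(1,2) less.prems(1,2)] by blast
  next
    case False
    then have "verts G \<noteq> {}" by blast
    then obtain x where x: "source G B x" "\<And>y. y \<in> verts G \<Longrightarrow> c x \<le> c y"
      using source_at_minimum[OF assms(1) _ less.prems(1,2)] by blast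
    have xv: "x \<in> verts G" using x(1) unfolding source_def by blast
    have cx: "c x < m"
    \<comment> \<open>If the minimum already reached the upper bound \<open>m\<close>, then
      \<open>c\<close> would be constantly \<open>m\<close>.\<close>
    proof (rule ccontr)
      assume "\<not> c x < m"
      then have "c y = m" if "y \<in> verts G" for y
        using x(2)[OF that] less.prems(3)[OF that] by simp
      then show False using False by blast
    qed
    define B' where "B' = reverse_at x B"
    define c' where "c' = (\<lambda>z. c z + of_bool (z = x))"
    have B': "B' \<in> Acyc G"
      unfolding B'_def using reverse_at_Acyc[OF assms(1) less.prems(1) x(1)] .
    have c': "gradient G c' A B'"
      unfolding B'_def c'_def
      using gradient_trans[OF less.prems(2) gradient_reverse_at[OF assms(1) less.prems(1) x(1)]] .
    have le: "c' z \<le> m" if "z \<in> verts G" for z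
      using less.prems(3)[OF that] cx unfolding c'_def by auto
    have "(\<Sum>z\<in>verts G. m - c' z) < (\<Sum>z\<in>verts G. m - c z)"
      by (rule sum_strict_mono_ex1[OF fin]) (use xv in \<open>auto simp: c'_def\<close>)
    moreover have "0 \<le> (\<Sum>z\<in>verts G. m - c' z)"
      by (rule sum_nonneg) (simp add: le)
    ultimately have "nat (\<Sum>z\<in>verts G. m - c' z) < nat (\<Sum>z\<in>verts G. m - c z)"
      by linarith
    then have "(B', A) \<in> (click G)\<^sup>*"
      using less.hyps B' c' le by blast
    moreover have "(B, B') \<in> click G"
      unfolding click_def B'_def using less.prems(1) x(1) by blast
    ultimately show ?thesis by (meson converse_rtrancl_into_rtrancl)
  qed
qed

lemma kappa_iff:
  assumes "simple_graph G"
  shows "(A, B) \<in> kappa G \<longleftrightarrow> A \<in> Acyc G \<and> B \<in> Acyc G \<and> (\<exists>c. gradient G c A B)"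
proof -
  have "(A, B) \<in> (click G)\<^sup>*" if "A \<in> Acyc G" "B \<in> Acyc G" "gradient G c A B" for c
  \<comment> \<open>\<open>gradient_clicks\<close> runs from its second orientation to its first, so
    the roles are swapped and the potential negated. Finiteness provides the upper bound.\<close>
  proof (rule gradient_clicks[OF assms that(2,1) gradient_sym[OF that(3)]])
    have "finite (verts G)" using assms unfolding simple_graph_def by blast
    then show "- c x \<le> Max ((\<lambda>x. - c x) ` verts G)" if "x \<in> verts G" for x
      using that by simp
  qed
  then show ?thesis
    using clicks_gradient[OF assms] unfolding kappa_def by blast
qed

text \<open>Symmetry is not visible from clicks, which only turn sources into sinks; for potentials
  it is a change of sign.\<close>

lemma kappa_equiv: "simple_graph G \<Longrightarrow> equiv (Acyc G) (kappa G)"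
  by (rule equivI)
    (auto simp: refl_on_def sym_def trans_def kappa_iff
      dest: gradient_sym gradient_trans intro: gradient_refl)

lemma kappa_class_eq_iff:
  assumes "simple_graph G" "A \<in> Acyc G" "B \<in> Acyc G"
  shows "kappa_class G A = kappa_class G B \<longleftrightarrow> (\<exists>c. gradient G c A B)"
  unfolding kappa_class_def
  using eq_equiv_class_iff[OF kappa_equiv[OF assms(1)] assms(2,3)] kappa_iff[OF assms(1)] assms(2,3)
  by blast

section \<open>Orientations with a unique source\<close>

definition rooted :: "'a graph \<Rightarrow> 'a \<Rightarrow> ('a \<times> 'a) set set" where
  "rooted G v = {A \<in> Acyc G. \<forall>x. source G A x \<longleftrightarrow> x = v}"

lemma rootedI:
  assumes "A \<in> Acyc G" "v \<in> verts G" "\<And>y. (y, v) \<notin> A"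
    and "\<And>x. x \<in> verts G \<Longrightarrow> x \<noteq> v \<Longrightarrow> \<exists>y. (y, x) \<in> A"
  shows "A \<in> rooted G v"
  using assms unfolding rooted_def source_def by blast

lemma rootedD:
  assumes "A \<in> rooted G v"
  shows "A \<in> Acyc G" "source G A v" "v \<in> verts G" "(y, v) \<notin> A"
    "x \<in> verts G \<Longrightarrow> x \<noteq> v \<Longrightarrow> \<exists>y. (y, x) \<in> A"
  using assms unfolding rooted_def source_def by blast+

text \<open>The minimum of \<open>c\<close> is attained at some source of \<open>B\<close>, and
  \<open>v\<close> is the only source.\<close>

lemma rooted_minimum:
  assumes "simple_graph G" "B \<in> rooted G v" "gradient G c A B" "x \<in> verts G"
  shows "c v \<le> c x"
proof -
  have "verts G \<noteq> {}" using assms(4) by blast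
  then obtain z where "source G B z" "\<forall>y\<in>verts G. c z \<le> c y"
    using source_at_minimum[OF assms(1) _ rootedD(1)[OF assms(2)] assms(3)] by blast
  then show ?thesis using assms(2,4) unfolding rooted_def by auto
qed

text \<open>Both \<open>c\<close> and its negative are minimal at \<open>v\<close>, so
  \<open>c\<close> is constant.\<close>

lemma rooted_unique:
  assumes "simple_graph G" "A \<in> rooted G v" "B \<in> rooted G v" "gradient G c A B"
  shows "A = B"
proof (rule gradient_const_eq[OF assms(1) rootedD(1)[OF assms(2)] rootedD(1)[OF assms(3)] assms(4)])
  show "c x = c v" if "x \<in> verts G" for x
    using rooted_minimum[OF assms(1,3,4) that]
      rooted_minimum[OF assms(1,2) gradient_sym[OF assms(4)] that] by simp
qed

text \<open>Click sources other than \<open>v\<close> as long as possible: the click counts of neighbours differ by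
  at most one and \<open>v\<close> is never clicked, so distances from \<open>v\<close> bound the number of clicks.\<close>

lemma rooted_exists:
  assumes "simple_graph G" "connected_graph G" "v \<in> verts G" "A \<in> Acyc G"
  shows "\<exists>B \<in> rooted G v. \<exists>c. gradient G c A B"
proof -
  have fin: "finite (verts G)" using assms(1) unfolding simple_graph_def by blast
  \<comment> \<open>\<open>k\<close> is the total click count, with no click at \<open>v\<close>. A
    largest such \<open>k\<close> exists by the bound below.\<close>
  define P where "P k \<longleftrightarrow> (\<exists>B c. B \<in> Acyc G \<and> gradient G c A B \<and> c v = 0 \<and> (\<forall>x. 0 \<le> c x) \<and>
    (\<Sum>x\<in>verts G. c x) = int k)" for k
  have "P 0"
    unfolding P_def by (intro exI[of _ A] exI[of _ "\<lambda>x. 0"]) (simp add: assms(4) gradient_refl)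
  have "\<forall>x\<in>verts G. \<exists>m. (v, x) \<in> adjacency G ^^ m"
    using assms(2,3) unfolding connected_graph_def by (meson rtrancl_imp_relpow)
  then obtain d where d: "\<And>x. x \<in> verts G \<Longrightarrow> (v, x) \<in> adjacency G ^^ d x" by metis
  \<comment> \<open>Along an edge \<open>c\<close> changes by at most one, starting from 0 at
    \<open>v\<close>; a walk of length \<open>m\<close> therefore bounds \<open>c\<close> by
    \<open>m\<close>.\<close>
  have dist: "c x \<le> int m"
    if "gradient G c A B" "c v = 0" "(v, x) \<in> adjacency G ^^ m" for B c x m
    using that(3)
  proof (induction m arbitrary: x)
    case 0
    then show ?case using that(2) by simp
  next
    case (Suc m)
    then obtain y where y: "(v, y) \<in> adjacency G ^^ m" "(y, x) \<in> adjacency G" by auto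
    then have "c x \<le> c y + 1"
      using gradientD[OF that(1), of y x]
      by (auto simp: adjacency_def of_bool_def split: if_splits)
    then show ?case using Suc.IH[OF y(1)] by simp
  qed
  have bound: "\<forall>k. P k \<longrightarrow> k < Suc (\<Sum>x\<in>verts G. d x)"
  proof (intro allI impI)
    fix k assume "P k"
    then obtain B c where c: "gradient G c A B" "c v = 0" "(\<Sum>x\<in>verts G. c x) = int k"
      unfolding P_def by blast
    have "(\<Sum>x\<in>verts G. c x) \<le> (\<Sum>x\<in>verts G. int (d x))"
      by (rule sum_mono) (use dist[OF c(1,2)] d in blast)
    then show "k < Suc (\<Sum>x\<in>verts G. d x)"
      using c(3) by (simp flip: of_nat_sum)
  qed
  obtain k where k: "P k" "\<And>j. P j \<Longrightarrow> j \<le> k"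
    using ex_has_greatest_nat[of P 0 "\<lambda>k. k"] \<open>P 0\<close> bound by blast
  then obtain B c where B: "B \<in> Acyc G" and c: "gradient G c A B" "c v = 0" "\<forall>x. 0 \<le> c x"
    "(\<Sum>x\<in>verts G. c x) = int k"
    unfolding P_def by blast
  \<comment> \<open>Clicking a second source would give \<open>P (Suc k)\<close>, against
    maximality.\<close>
  have only: "x = v" if "source G B x" for x
  proof (rule ccontr)
    assume "x \<noteq> v"
    have "x \<in> verts G" using that unfolding source_def by blast
    then have "(\<Sum>z\<in>verts G. c z + of_bool (z = x)) = int (Suc k)"
      using c(4) fin by (simp add: sum.distrib of_bool_def)
    then have "P (Suc k)"
      unfolding P_def
      by (intro exI[of _ "reverse_at x B"] exI[of _ "\<lambda>z. c z + of_bool (z = x)"])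
        (use c \<open>x \<noteq> v\<close> in \<open>simp add: reverse_at_Acyc[OF assms(1) B that]
          gradient_trans[OF c(1) gradient_reverse_at[OF assms(1) B that]]\<close>)
    then show False using k(2) by fastforce
  qed
  have "verts G \<noteq> {}" using assms(3) by blast
  then obtain s where "source G B s"
    using source_at_minimum[OF assms(1) _ B c(1)] by blast
  then have "B \<in> rooted G v"
    using only B unfolding rooted_def by blast
  then show ?thesis using c(1) by blast
qed

lemma kappa_class_rooted_bij:
  assumes "simple_graph G" "connected_graph G" "v \<in> verts G"
  shows "bij_betw (kappa_class G) (rooted G v) (Acyc G // kappa G)"
proof (rule bij_betw_imageI)
  show "inj_on (kappa_class G) (rooted G v)"
    using kappa_class_eq_iff[OF assms(1)] rooted_unique[OF assms(1)] rootedD(1)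
    by (metis inj_onI)
  show "kappa_class G ` rooted G v = Acyc G // kappa G"
  proof
    show "kappa_class G ` rooted G v \<subseteq> Acyc G // kappa G"
      using rootedD(1) by (fastforce simp: quotient_def kappa_class_def)
    show "Acyc G // kappa G \<subseteq> kappa_class G ` rooted G v"
    proof
      fix C assume "C \<in> Acyc G // kappa G"
      then obtain A where A: "A \<in> Acyc G" "C = kappa_class G A"
        by (auto simp: quotient_def kappa_class_def)
      obtain B c where B: "B \<in> rooted G v" "gradient G c A B"
        using rooted_exists[OF assms A(1)] by blast
      then have "C = kappa_class G B"
        using kappa_class_eq_iff[OF assms(1) A(1) rootedD(1)[OF B(1)]] A(2) by blast
      then show "C \<in> kappa_class G ` rooted G v" using B(1) by blast
    qed
  qed
qed

section \<open>Deletion and contraction\<close>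

definition merge :: "'a \<Rightarrow> 'a \<Rightarrow> 'a \<Rightarrow> 'a" where
  "merge v w x = (if x = w then v else x)"

text \<open>The arc \<open>(v, w)\<close> is dropped because its image would be the loop
  \<open>(v, v)\<close>.\<close>

definition contract_arcs :: "'a \<Rightarrow> 'a \<Rightarrow> ('a \<times> 'a) set \<Rightarrow> ('a \<times> 'a) set" where
  "contract_arcs v w A = map_prod (merge v w) (merge v w) ` (A - {(v, w)})"

text \<open>Intended inverse of \<open>contract_arcs\<close>: each edge takes the direction of its
  image, and the contracted edge points from \<open>v\<close> to \<open>w\<close>.\<close>

definition expand_arcs :: "'a graph \<Rightarrow> 'a \<Rightarrow> 'a \<Rightarrow> ('a \<times> 'a) set \<Rightarrow> ('a \<times> 'a) set" where
  "expand_arcs G v w D =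
     {(x, y). {x, y} \<in> edges G \<and> ((x, y) = (v, w) \<or> (merge v w x, merge v w y) \<in> D)}"

locale graph_with_edge =
  fixes G :: "'a graph" and v w :: 'a
  assumes simple: "simple_graph G" and edge: "{v, w} \<in> edges G"
begin

abbreviation "G_del \<equiv> delete_edge G {v, w}"
abbreviation "G_con \<equiv> contract_edge G v w"

lemma ends: "v \<in> verts G" "w \<in> verts G" "v \<noteq> w"
  using edge_endpoints[OF simple edge] by auto

section \<open>The deleted and the contracted graph\<close>

lemma del_verts: "verts G_del = verts G"
  unfolding delete_edge_def by simp

lemma del_edges: "edges G_del = edges G - {{v, w}}"
  unfolding delete_edge_def by simp

lemma del_simple: "simple_graph G_del"
  using simple unfolding simple_graph_def del_verts del_edges by blast

lemma con_verts: "verts G_con = verts G - {w}"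
  unfolding contract_edge_def by simp

lemma con_edges: "edges G_con = (\<lambda>f. merge v w ` f) ` edges G - {{v}}"
  unfolding contract_edge_def merge_def by simp

lemma merge_eq_iff: "merge v w a = merge v w b \<longleftrightarrow> a = b \<or> {a, b} = {v, w}"
  unfolding merge_def by (auto simp: doubleton_eq_iff)

lemma edgeE:
  assumes "e \<in> edges G"
  obtains a b where "e = {a, b}" "a \<noteq> b"
  using simple assms unfolding simple_graph_def by (auto simp: card_2_iff)

text \<open>Only \<open>v\<close> and \<open>w\<close> are identified, so \<open>{v}\<close> is the
  only loop that can arise; \<open>x \<noteq> y\<close> expresses its removal.\<close>

lemma con_edge_iff:
  "{x, y} \<in> edges G_con \<longleftrightarrow>
     x \<noteq> y \<and> (\<exists>a b. {a, b} \<in> edges G \<and> merge v w a = x \<and> merge v w b = y)"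
proof
  assume xy: "{x, y} \<in> edges G_con"
  then obtain e where e: "e \<in> edges G" "{x, y} = merge v w ` e" "{x, y} \<noteq> {v}"
    unfolding con_edges by blast
  then obtain a b where ab: "e = {a, b}" "a \<noteq> b" using edgeE by blast
  then have img: "{x, y} = {merge v w a, merge v w b}" using e(2) by simp
  have "merge v w a \<noteq> merge v w b"
  proof
    assume eq: "merge v w a = merge v w b"
    then have "{a, b} = {v, w}" using ab(2) merge_eq_iff by blast
    then have "merge v w a = v" by (auto simp: merge_def doubleton_eq_iff)
    then show False using img eq e(3) by simp
  qed
  then show "x \<noteq> y \<and> (\<exists>a b. {a, b} \<in> edges G \<and> merge v w a = x \<and> merge v w b = y)"
    using img e(1) ab(1) by (metis doubleton_eq_iff insert_commute)
next
  assume "x \<noteq> y \<and> (\<exists>a b. {a, b} \<in> edges G \<and> merge v w a = x \<and> merge v w b = y)"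
  then obtain a b where ab: "x \<noteq> y" "{a, b} \<in> edges G" "merge v w a = x" "merge v w b = y"
    by blast
  have "{x, y} = merge v w ` {a, b}" using ab by simp
  moreover have "{x, y} \<noteq> {v}" using ab(1) by auto
  ultimately show "{x, y} \<in> edges G_con" unfolding con_edges using ab(2) by blast
qed

lemma merge_verts: "a \<in> verts G \<Longrightarrow> merge v w a \<in> verts G_con"
  using ends unfolding merge_def con_verts by auto

lemma con_simple: "simple_graph G_con"
  unfolding simple_graph_def
proof (intro conjI ballI)
  show "finite (verts G_con)" using simple unfolding simple_graph_def con_verts by blast
next
  fix e assume e: "e \<in> edges G_con"
  then obtain f where f: "f \<in> edges G" "e = merge v w ` f" unfolding con_edges by blast
  moreover obtain a b where "f = {a, b}" using edgeE[OF f(1)] .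
  ultimately have ab: "{a, b} \<in> edges G" "e = {merge v w a, merge v w b}" by simp_all
  then show "e \<subseteq> verts G_con"
    using edge_endpoints[OF simple ab(1)] merge_verts by simp
  show "card e = 2"
    using e con_edge_iff[of "merge v w a" "merge v w b"] unfolding ab(2) by simp
qed

text \<open>\<open>merge\<close> sends walks to walks, a step along \<open>{v, w}\<close> becoming
  stationary.\<close>

lemma con_connected:
  assumes "connected_graph G"
  shows "connected_graph G_con"
proof -
  have step: "(merge v w x, merge v w y) \<in> (adjacency G_con)\<^sup>*" if "(x, y) \<in> adjacency G" for x y
  proof (cases "merge v w x = merge v w y")
    case False
    then have "(merge v w x, merge v w y) \<in> adjacency G_con"
      using that con_edge_iff unfolding adjacency_def by blast
    then show ?thesis by blast
  qed simp
  have path: "(merge v w x, merge v w y) \<in> (adjacency G_con)\<^sup>*" if "(x, y) \<in> (adjacency G)\<^sup>*" for x y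
    using that by (induction rule: rtrancl_induct) (auto intro: step rtrancl_trans)
  show ?thesis
    unfolding connected_graph_def
  proof (intro conjI ballI)
    show "verts G_con \<noteq> {}" using ends unfolding con_verts by blast
    fix x y assume "x \<in> verts G_con" "y \<in> verts G_con"
    then show "(x, y) \<in> (adjacency G_con)\<^sup>*"
      using assms path[of x y] unfolding connected_graph_def con_verts merge_def by auto
  qed
qed

text \<open>A connected graph has at most one component, and deleting an edge that is not a bridge
  does not increase the count.\<close>

lemma del_connected:
  assumes "connected_graph G" "cycle_edge G {v, w}"
  shows "connected_graph G_del"
proof -
  let ?R = "\<lambda>H. {(x, y). x \<in> verts G \<and> y \<in> verts G \<and> (x, y) \<in> (adjacency H)\<^sup>*}"
  have fin: "finite (verts G)" using simple unfolding simple_graph_def by blast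
  have "?R G `` {x} = verts G" if "x \<in> verts G" for x
    using assms(1) that unfolding connected_graph_def by auto
  then have "components G \<subseteq> {verts G}"
    unfolding components_def quotient_def by blast
  then have "card (components G) \<le> 1"
    using card_mono[of "{verts G}"] by simp
  moreover have "card (components G_del) \<le> card (components G)"
    using assms(2) unfolding cycle_edge_def bridge_def by auto
  ultimately have le: "card (components G_del) \<le> Suc 0" by simp
  \<comment> \<open>Finiteness excludes the default \<open>card\<close> value 0 of infinite sets, so
    the bound really means at most one component.\<close>
  have "components G_del \<subseteq> Pow (verts G)"
    unfolding components_def quotient_def del_verts by blast
  then have finc: "finite (components G_del)"
    using fin by (meson finite_Pow_iff finite_subset)
  have "(x, y) \<in> (adjacency G_del)\<^sup>*" if "x \<in> verts G" "y \<in> verts G" for x y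
  proof -
    have "?R G_del `` {z} \<in> components G_del" if "z \<in> verts G" for z
      using that unfolding components_def quotient_def del_verts by blast
    then have "?R G_del `` {x} = ?R G_del `` {y}"
      using le that finc by (metis (no_types, lifting) card_le_Suc0_iff_eq)
    then show ?thesis using that by blast
  qed
  then show ?thesis
    using ends unfolding connected_graph_def del_verts by blast
qed

lemma source_arc:
  assumes "A \<in> Acyc G" "source G A v"
  shows "(v, w) \<in> A"
  using assms orientation_flip[OF Acyc_orientation[OF assms(1)] edge] unfolding source_def by blast

subsection \<open>Deletion\<close>

lemma del_Acyc:
  assumes "A \<in> Acyc G" "(v, w) \<in> A"
  shows "A - {(v, w)} \<in> Acyc G_del"
proof -
  have o: "orientation G A" using assms(1) by (rule Acyc_orientation)
  have wv: "(w, v) \<notin> A" using orientation_flip[OF o edge] assms(2) by blast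
  have "orientation G_del (A - {(v, w)})"
    unfolding orientation_def
  proof (intro conjI allI impI subrelI)
    show "(x, y) \<in> adjacency G_del" if "(x, y) \<in> A - {(v, w)}" for x y
      using that orientation_edge[OF o, of x y] wv unfolding adjacency_def del_edges
      by (auto simp: doubleton_eq_iff)
    show "((x, y) \<in> A - {(v, w)}) \<noteq> ((y, x) \<in> A - {(v, w)})" if "{x, y} \<in> edges G_del" for x y
      using that orientation_flip[OF o, of x y] unfolding del_edges by auto
  qed
  moreover have "acyclic (A - {(v, w)})"
    using assms(1) acyclic_subset unfolding Acyc_def by blast
  ultimately show ?thesis unfolding Acyc_def by blast
qed

lemma del_gradient:
  assumes "gradient G c A B"
  shows "gradient G_del c (A - {(v, w)}) (B - {(v, w)})"
  unfolding gradient_def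
proof (intro allI impI)
  fix x y assume "{x, y} \<in> edges G_del"
  then have "{x, y} \<in> edges G" "(x, y) \<noteq> (v, w)" unfolding del_edges by auto
  then show "of_bool ((x, y) \<in> B - {(v, w)}) = of_bool ((x, y) \<in> A - {(v, w)}) + c y - c x"
    using gradientD[OF assms] by simp
qed

lemma del_orient:
  assumes "(v, w) \<in> orient G p"
  shows "orient G_del p = orient G p - {(v, w)}"
  using assms unfolding orient_def del_edges by (auto simp: doubleton_eq_iff)

text \<open>No arc of \<open>D\<close> enters \<open>v\<close>, so no path leads from
  \<open>w\<close> back to \<open>v\<close> and the new arc closes no cycle.\<close>

lemma insert_rooted:
  assumes "D \<in> rooted G_del v"
  shows "insert (v, w) D \<in> rooted G v"
proof (rule rootedI)
  have D: "D \<in> Acyc G_del" using rootedD(1)[OF assms] .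
  then have o: "orientation G_del D" by (rule Acyc_orientation)
  have D_edge: "{x, y} \<in> edges G" "{x, y} \<noteq> {v, w}" if "(x, y) \<in> D" for x y
    using orientation_edge[OF o that] unfolding del_edges by auto
  have "orientation G (insert (v, w) D)"
    unfolding orientation_def
  proof (intro conjI allI impI subrelI)
    show "(x, y) \<in> adjacency G" if "(x, y) \<in> insert (v, w) D" for x y
      using that D_edge edge unfolding adjacency_def by auto
    show "((x, y) \<in> insert (v, w) D) \<noteq> ((y, x) \<in> insert (v, w) D)" if xy: "{x, y} \<in> edges G" for x y
    proof (cases "{x, y} = {v, w}")
      case True
      then have "(x, y) \<notin> D" "(y, x) \<notin> D" using D_edge(2) by (auto simp: insert_commute)
      then show ?thesis using True ends by (auto simp: doubleton_eq_iff)
    next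
      case False
      then have "{x, y} \<in> edges G_del" using xy unfolding del_edges by blast
      then show ?thesis using orientation_flip[OF o] False by auto
    qed
  qed
  moreover have "(w, v) \<notin> D\<^sup>*"
    using rootedD(4)[OF assms] ends(3) by (metis rtranclE)
  then have "acyclic (insert (v, w) D)"
    using D unfolding Acyc_def acyclic_insert by blast
  ultimately show "insert (v, w) D \<in> Acyc G" unfolding Acyc_def by blast
  show "v \<in> verts G" by (rule ends)
  show "(y, v) \<notin> insert (v, w) D" for y
    using rootedD(4)[OF assms] ends(3) by blast
  show "\<exists>y. (y, x) \<in> insert (v, w) D" if "x \<in> verts G" "x \<noteq> v" for x
    using rootedD(5)[OF assms, unfolded del_verts] that by blast
qed

text \<open>A second arc into \<open>w\<close> is exactly what keeps \<open>w\<close> from becoming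
  a source when \<open>(v, w)\<close> is removed.\<close>

lemma del_rooted_bij:
  "bij_betw (\<lambda>A. A - {(v, w)}) {A \<in> rooted G v. \<not> (\<forall>x. (x, w) \<in> A \<longrightarrow> x = v)} (rooted G_del v)"
proof (rule bij_betw_byWitness[where f' = "insert (v, w)"])
  have arc: "(v, w) \<in> A" if "A \<in> rooted G v" for A
    using source_arc rootedD(1,2)[OF that] by blast
  have no_arc: "(v, w) \<notin> D" if "D \<in> rooted G_del v" for D
    using orientation_edge[OF Acyc_orientation[OF rootedD(1)[OF that]]] unfolding del_edges by blast
  show "\<forall>A\<in>{A \<in> rooted G v. \<not> (\<forall>x. (x, w) \<in> A \<longrightarrow> x = v)}. insert (v, w) (A - {(v, w)}) = A"
    using arc by blast
  show "\<forall>D\<in>rooted G_del v. insert (v, w) D - {(v, w)} = D"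
    using no_arc by blast
  show "(\<lambda>A. A - {(v, w)}) ` {A \<in> rooted G v. \<not> (\<forall>x. (x, w) \<in> A \<longrightarrow> x = v)} \<subseteq> rooted G_del v"
  proof (rule image_subsetI)
    fix A assume "A \<in> {A \<in> rooted G v. \<not> (\<forall>x. (x, w) \<in> A \<longrightarrow> x = v)}"
    then obtain z where A: "A \<in> rooted G v" and z: "(z, w) \<in> A" "z \<noteq> v" by blast
    show "A - {(v, w)} \<in> rooted G_del v"
    proof (rule rootedI, unfold del_verts)
      show "A - {(v, w)} \<in> Acyc G_del" using del_Acyc rootedD(1)[OF A] arc[OF A] by blast
      show "v \<in> verts G" by (rule ends)
      show "(y, v) \<notin> A - {(v, w)}" for y using rootedD(4)[OF A] by blast
      show "\<exists>y. (y, x) \<in> A - {(v, w)}" if "x \<in> verts G" "x \<noteq> v" for x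
        using rootedD(5)[OF A that] z by blast
    qed
  qed
  show "insert (v, w) ` rooted G_del v \<subseteq> {A \<in> rooted G v. \<not> (\<forall>x. (x, w) \<in> A \<longrightarrow> x = v)}"
  proof (rule image_subsetI)
    fix D assume D: "D \<in> rooted G_del v"
    then obtain z where "(z, w) \<in> D"
      using rootedD(5)[OF D, unfolded del_verts] ends by metis
    then show "insert (v, w) D \<in> {A \<in> rooted G v. \<not> (\<forall>x. (x, w) \<in> A \<longrightarrow> x = v)}"
      using insert_rooted[OF D] no_arc[OF D] by auto
  qed
qed

subsection \<open>Contraction\<close>

lemma con_permutations_iff:
  "v # r \<in> permutations_of_set (verts G_con) \<longleftrightarrow> v # w # r \<in> permutations_of_set (verts G)"
  using ends unfolding permutations_of_set_def con_verts by auto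

text \<open>Removing \<open>w\<close> from second place shifts all later vertices equally; only the
  comparison of \<open>v\<close> with \<open>w\<close> turns into a tie.\<close>

lemma position_merge:
  assumes "v # w # r \<in> permutations_of_set (verts G)" "a \<in> verts G" "b \<in> verts G"
  shows "position (v # r) (merge v w a) < position (v # r) (merge v w b) \<longleftrightarrow>
    position (v # w # r) a < position (v # w # r) b \<and> (a, b) \<noteq> (v, w)"
proof -
  have r: "set (v # w # r) = verts G" "distinct (v # w # r)"
    using assms(1) by (auto simp: permutations_of_set_def)
  have full: "position (v # w # r) x = (if x = v then 0 else if x = w then 1 else position r x + 2)"
    if "x \<in> verts G" for x
    using that r by (auto simp: position_Cons)
  have con: "position (v # r) (merge v w x) = (if x = v \<or> x = w then 0 else position r x + 1)"
    if "x \<in> verts G" for x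
    using that r by (auto simp: position_Cons merge_def)
  show ?thesis
    using assms(2,3) ends(3) by (simp add: full con)
qed

text \<open>Identifies contraction of arcs with the induced order, so that acyclicity comes from
  \<open>orient_Acyc\<close> instead of an argument about cycles.\<close>

lemma contract_orient:
  assumes "v # w # r \<in> permutations_of_set (verts G)"
  shows "contract_arcs v w (orient G (v # w # r)) = orient G_con (v # r)"
proof -
  have "(x, y) \<in> contract_arcs v w (orient G (v # w # r)) \<longleftrightarrow> (x, y) \<in> orient G_con (v # r)" for x y
  proof -
    have "(x, y) \<in> contract_arcs v w (orient G (v # w # r)) \<longleftrightarrow>
      (\<exists>a b. {a, b} \<in> edges G \<and> merge v w a = x \<and> merge v w b = y \<and>
        position (v # w # r) a < position (v # w # r) b \<and> (a, b) \<noteq> (v, w))"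
      unfolding contract_arcs_def orient_def by auto
    also have "\<dots> \<longleftrightarrow> (\<exists>a b. {a, b} \<in> edges G \<and> merge v w a = x \<and> merge v w b = y \<and>
        position (v # r) x < position (v # r) y)"
      using position_merge[OF assms] edge_endpoints[OF simple] by metis
    also have "\<dots> \<longleftrightarrow> (x, y) \<in> orient G_con (v # r)"
      unfolding orient_def using con_edge_iff by auto
    finally show ?thesis .
  qed
  then show ?thesis by auto
qed

lemma expand_orient:
  assumes "v # w # r \<in> permutations_of_set (verts G)"
  shows "expand_arcs G v w (orient G_con (v # r)) = orient G (v # w # r)"
proof -
  have "(x, y) \<in> expand_arcs G v w (orient G_con (v # r)) \<longleftrightarrow> (x, y) \<in> orient G (v # w # r)" for x y
  proof (cases "{x, y} \<in> edges G")
    case True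
    have vw: "position (v # w # r) v < position (v # w # r) w"
      using ends(3) by (simp add: position_Cons)
    have "(merge v w x, merge v w y) \<in> orient G_con (v # r) \<longleftrightarrow>
        position (v # w # r) x < position (v # w # r) y \<and> (x, y) \<noteq> (v, w)"
      using position_merge[OF assms edge_endpoints(1,2)[OF simple True]] con_edge_iff True
      unfolding orient_def by auto
    then show ?thesis
      using True vw unfolding expand_arcs_def orient_def by auto
  next
    case False
    then show ?thesis unfolding expand_arcs_def orient_def by simp
  qed
  then show ?thesis by auto
qed

text \<open>Two edges of \<open>G\<close> may merge into one. Their directions agree because
  \<open>v\<close> and \<open>w\<close> precede all other vertices, so either edge determines the
  direction of the image.\<close>

lemma contract_arcs_iff:
  assumes "v # w # r \<in> permutations_of_set (verts G)" "{a, b} \<in> edges G"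
    and "merge v w a \<noteq> merge v w b"
  shows "(merge v w a, merge v w b) \<in> contract_arcs v w (orient G (v # w # r)) \<longleftrightarrow>
    (a, b) \<in> orient G (v # w # r)"
proof -
  have "(a, b) \<noteq> (v, w)" using assms(3) merge_eq_iff by blast
  moreover have "{merge v w a, merge v w b} \<in> edges G_con"
    using assms(2,3) con_edge_iff by blast
  ultimately show ?thesis
    using assms(2) position_merge[OF assms(1) edge_endpoints(1,2)[OF simple assms(2)]]
    unfolding contract_orient[OF assms(1)] by (simp add: orient_def)
qed

text \<open>Since \<open>c v = c w\<close>, the potential is invariant under \<open>merge\<close>,
  and each edge of the contraction inherits the equation of any preimage.\<close>

lemma con_gradient:
  assumes "v # w # r \<in> permutations_of_set (verts G)" "v # w # s \<in> permutations_of_set (verts G)"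
    and "gradient G c (orient G (v # w # r)) (orient G (v # w # s))" "c v = c w"
  shows "gradient G_con c (contract_arcs v w (orient G (v # w # r)))
    (contract_arcs v w (orient G (v # w # s)))"
  unfolding gradient_def
proof (intro allI impI)
  fix x y assume "{x, y} \<in> edges G_con"
  then obtain a b where ab: "{a, b} \<in> edges G" "merge v w a = x" "merge v w b = y" "x \<noteq> y"
    unfolding con_edge_iff by blast
  have c: "c (merge v w z) = c z" for z
    using assms(4) unfolding merge_def by simp
  show "of_bool ((x, y) \<in> contract_arcs v w (orient G (v # w # s))) =
      of_bool ((x, y) \<in> contract_arcs v w (orient G (v # w # r))) + c y - c x"
    using gradientD[OF assms(3) ab(1)] contract_arcs_iff[OF assms(1) ab(1)]
      contract_arcs_iff[OF assms(2) ab(1)] ab(2-4) c[of a] c[of b] by simp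
qed

text \<open>If \<open>(v, w)\<close> is the only arc into \<open>w\<close>, no arc enters the pair
  from outside, so the merged vertex is a source. Conversely, expanding a source \<open>v\<close>
  creates no arc into the pair except \<open>(v, w)\<close>. All other vertices keep an incoming
  arc.\<close>

lemma con_rooted_bij:
  "bij_betw (contract_arcs v w) {A \<in> rooted G v. \<forall>x. (x, w) \<in> A \<longrightarrow> x = v} (rooted G_con v)"
proof (rule bij_betw_byWitness[where f' = "expand_arcs G v w"])
  have order: "\<exists>r. v # w # r \<in> permutations_of_set (verts G) \<and> A = orient G (v # w # r)"
    if "A \<in> rooted G v" "\<forall>x. (x, w) \<in> A \<longrightarrow> x = v" for A
    using orient_sources_first[OF simple rootedD(1,2)[OF that(1)] ends(2) ends(3)[symmetric]] that(2)
    by metis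
  have con_order: "\<exists>r. v # w # r \<in> permutations_of_set (verts G) \<and> D = orient G_con (v # r)"
    if "D \<in> rooted G_con v" for D
    using orient_source_first[OF con_simple rootedD(1,2)[OF that]] con_permutations_iff by metis
  show "\<forall>A\<in>{A \<in> rooted G v. \<forall>x. (x, w) \<in> A \<longrightarrow> x = v}. expand_arcs G v w (contract_arcs v w A) = A"
    using order contract_orient expand_orient by fastforce
  show "\<forall>D\<in>rooted G_con v. contract_arcs v w (expand_arcs G v w D) = D"
    using con_order contract_orient expand_orient by fastforce
  show "contract_arcs v w ` {A \<in> rooted G v. \<forall>x. (x, w) \<in> A \<longrightarrow> x = v} \<subseteq> rooted G_con v"
  proof (rule image_subsetI)
    fix A assume "A \<in> {A \<in> rooted G v. \<forall>x. (x, w) \<in> A \<longrightarrow> x = v}"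
    then have A: "A \<in> rooted G v" "\<And>x. (x, w) \<in> A \<Longrightarrow> x = v" by auto
    show "contract_arcs v w A \<in> rooted G_con v"
    proof (rule rootedI)
      obtain r where "v # w # r \<in> permutations_of_set (verts G)" "A = orient G (v # w # r)"
        using order A by blast
      then show "contract_arcs v w A \<in> Acyc G_con"
        using contract_orient orient_Acyc[OF con_simple] con_permutations_iff by simp
      show "v \<in> verts G_con" using ends unfolding con_verts by simp
      show "(y, v) \<notin> contract_arcs v w A" for y
        using A(2) rootedD(4)[OF A(1)] unfolding contract_arcs_def merge_def
        by (auto split: if_splits)
      show "\<exists>y. (y, x) \<in> contract_arcs v w A" if x: "x \<in> verts G_con" "x \<noteq> v" for x
      proof -
        have "x \<in> verts G" "x \<noteq> w" using x unfolding con_verts by auto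
        then obtain y where "(y, x) \<in> A - {(v, w)}" using rootedD(5)[OF A(1)] x(2) by blast
        then have "(merge v w y, merge v w x) \<in> contract_arcs v w A"
          unfolding contract_arcs_def by force
        then show ?thesis using \<open>x \<noteq> w\<close> unfolding merge_def by auto
      qed
    qed
  qed
  show "expand_arcs G v w ` rooted G_con v \<subseteq> {A \<in> rooted G v. \<forall>x. (x, w) \<in> A \<longrightarrow> x = v}"
  proof (rule image_subsetI)
    fix D assume D: "D \<in> rooted G_con v"
    have merged: "merge v w x = v \<longleftrightarrow> x = v \<or> x = w" for x
      unfolding merge_def by auto
    have "expand_arcs G v w D \<in> rooted G v"
    proof (rule rootedI)
      show "expand_arcs G v w D \<in> Acyc G"
        using con_order[OF D] expand_orient orient_Acyc[OF simple] by metis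
      show "v \<in> verts G" by (rule ends)
      show "(y, v) \<notin> expand_arcs G v w D" for y
        using rootedD(4)[OF D] ends(3) merged[of v] unfolding expand_arcs_def by auto
      show "\<exists>y. (y, x) \<in> expand_arcs G v w D" if x: "x \<in> verts G" "x \<noteq> v" for x
      proof (cases "x = w")
        case True
        then show ?thesis using edge unfolding expand_arcs_def by auto
      next
        case False
        then have "x \<in> verts G_con" using x unfolding con_verts by simp
        then obtain y where y: "(y, x) \<in> D" using rootedD(5)[OF D] x(2) by blast
        \<comment> \<open>The arc into \<open>x\<close> is lifted to an edge of \<open>G\<close>; as
          \<open>x\<close> is not the merged vertex, its head is \<open>x\<close> itself.\<close>
        then obtain a b where ab: "{a, b} \<in> edges G" "merge v w a = y" "merge v w b = x"
          using orientation_edge[OF Acyc_orientation[OF rootedD(1)[OF D]] y]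
          unfolding con_edge_iff by blast
        then have "b = x" using x(2) unfolding merge_def by (auto split: if_splits)
        then have "(a, x) \<in> expand_arcs G v w D"
          using ab y unfolding expand_arcs_def by simp
        then show ?thesis by blast
      qed
    qed
    moreover have "x = v" if "(x, w) \<in> expand_arcs G v w D" for x
      using that rootedD(4)[OF D] merged[of w] unfolding expand_arcs_def by auto
    ultimately show "expand_arcs G v w D \<in> {A \<in> rooted G v. \<forall>x. (x, w) \<in> A \<longrightarrow> x = v}"
      by blast
  qed
qed

section \<open>The map on click classes\<close>

text \<open>\<open>Theta\<close> read on unique-source representatives. The condition is a set
  membership so that two bijections with disjoint domains can be glued directly.\<close>

definition rooted_map :: "('a \<times> 'a) set \<Rightarrow> ('a \<times> 'a) set set + ('a \<times> 'a) set set" where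
  "rooted_map A =
     (if A \<in> {A \<in> rooted G v. \<forall>x. (x, w) \<in> A \<longrightarrow> x = v}
      then Inr (kappa_class G_con (contract_arcs v w A))
      else Inl (kappa_class G_del (A - {(v, w)})))"

lemma rooted_map_bij:
  assumes "connected_graph G" "cycle_edge G {v, w}"
  shows "bij_betw rooted_map (rooted G v)
    ((Acyc G_del // kappa G_del) <+> (Acyc G_con // kappa G_con))"
proof -
  let ?S = "{A \<in> rooted G v. \<forall>x. (x, w) \<in> A \<longrightarrow> x = v}"
  let ?M = "{A \<in> rooted G v. \<not> (\<forall>x. (x, w) \<in> A \<longrightarrow> x = v)}"
  have Inl: "bij_betw Inl X (Inl ` X)" for X :: "('a \<times> 'a) set set set"
    by (simp add: inj_on_imp_bij_betw)
  have Inr: "bij_betw Inr X (Inr ` X)" for X :: "('a \<times> 'a) set set set"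
    by (simp add: inj_on_imp_bij_betw)
  have "v \<in> verts G_con" "v \<in> verts G_del"
    using ends unfolding con_verts del_verts by auto
  then have
    con: "bij_betw (Inr \<circ> (kappa_class G_con \<circ> contract_arcs v w)) ?S (Inr ` (Acyc G_con // kappa G_con))"
    and del: "bij_betw (Inl \<circ> (kappa_class G_del \<circ> (\<lambda>A. A - {(v, w)}))) ?M (Inl ` (Acyc G_del // kappa G_del))"
    using bij_betw_trans[OF bij_betw_trans[OF con_rooted_bij
        kappa_class_rooted_bij[OF con_simple con_connected[OF assms(1)]]] Inr]
      bij_betw_trans[OF bij_betw_trans[OF del_rooted_bij
        kappa_class_rooted_bij[OF del_simple del_connected[OF assms]]] Inl]
    by auto
  have "?S \<union> ?M = rooted G v" by blast
  moreover have "?S \<inter> ?M = {}" by blast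
  moreover have "Inr ` (Acyc G_con // kappa G_con) \<inter> Inl ` (Acyc G_del // kappa G_del) = {}" by blast
  ultimately show ?thesis
    using bij_betw_disjoint_Un[OF con del]
    unfolding rooted_map_def[abs_def] Plus_def comp_def by (simp add: Un_commute)
qed

section \<open>Evaluating \<open>Theta\<close> on unique-source representatives\<close>

lemma second_only_from_first:
  assumes "v # w # r \<in> permutations_of_set (verts G)" "(x, w) \<in> orient G (v # w # r)"
  shows "x = v"
proof -
  have "x \<in> set (v # w # r)"
    using assms edge_endpoints[OF simple] by (auto simp: orient_def permutations_of_set_def)
  then show ?thesis
    using assms(2) ends(3) by (auto simp: orient_def position_Cons split: if_splits)
qed

lemma source_hd:
  assumes "p \<in> permutations_of_set (verts G)" "hd p = v"
  shows "source G (orient G p) v"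
proof -
  have "p \<noteq> []" using assms(1) ends(1) by (auto simp: permutations_of_set_def)
  then obtain r where "p = v # r" using assms(2) by (cases p) auto
  then show ?thesis using ends(1) by (simp add: source_def orient_def position_Cons)
qed

text \<open>The indicator of \<open>(v, w)\<close> does not change, so neither does the potential
  across the edge. This lets the potential descend to the contraction.\<close>

lemma gradient_ends:
  assumes "(v, w) \<in> A" "(v, w) \<in> B" "gradient G c A B"
  shows "c v = c w"
  using gradientD[OF assms(3) edge] assms(1,2) by simp

lemma kappa_class_gradient:
  assumes "B \<in> kappa_class G A"
  obtains c where "A \<in> Acyc G" "B \<in> Acyc G" "gradient G c A B"
  using assms kappa_iff[OF simple] unfolding kappa_class_def by auto

text \<open>The case distinction of \<open>Theta\<close> quantifies over a whole class; this reads
  it off the unique-source orientation.\<close>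

lemma starts_vw_iff:
  assumes "A \<in> rooted G v"
  shows "starts_vw G v w (kappa_class G A) \<longleftrightarrow> (\<forall>x. (x, w) \<in> A \<longrightarrow> x = v)"
proof
  assume "starts_vw G v w (kappa_class G A)"
  then obtain r where r: "v # w # r \<in> permutations_of_set (verts G)"
    "orient G (v # w # r) \<in> kappa_class G A"
    unfolding starts_vw_def by blast
  then obtain c where c: "gradient G c A (orient G (v # w # r))"
    using kappa_class_gradient by blast
  have "(v, w) \<in> A" "(v, w) \<in> orient G (v # w # r)"
    using source_arc rootedD(1,2)[OF assms] orient_Acyc[OF simple r(1)] source_hd[OF r(1)] by auto
  then have cvw: "c v = c w" using gradient_ends c by blast
  show "\<forall>x. (x, w) \<in> A \<longrightarrow> x = v"
  proof (intro allI impI, rule ccontr)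
    fix x assume xw: "(x, w) \<in> A" and "x \<noteq> v"
    have E: "{x, w} \<in> edges G"
      using orientation_edge[OF Acyc_orientation[OF rootedD(1)[OF assms]] xw] .
    \<comment> \<open>The potential from \<open>A\<close> is largest at \<open>v\<close>, since its
      negative leads to \<open>A\<close> and is smallest there. Losing the arc \<open>(x, w)\<close>
      would force \<open>c x = c w + 1 = c v + 1\<close>.\<close>
    have "c x \<le> c v"
      using rooted_minimum[OF simple assms gradient_sym[OF c]] edge_endpoints[OF simple E] by fastforce
    moreover have "(x, w) \<notin> orient G (v # w # r)"
      using second_only_from_first[OF r(1)] \<open>x \<noteq> v\<close> by blast
    ultimately show False using gradientD[OF c E] xw cvw by simp
  qed
next
  assume "\<forall>x. (x, w) \<in> A \<longrightarrow> x = v"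
  then obtain r where "v # w # r \<in> permutations_of_set (verts G)" "orient G (v # w # r) = A"
    using orient_sources_first[OF simple rootedD(1,2)[OF assms] ends(2) ends(3)[symmetric]] by metis
  moreover have "A \<in> kappa_class G A"
    using rootedD(1)[OF assms] kappa_iff[OF simple] gradient_refl unfolding kappa_class_def by blast
  ultimately show "starts_vw G v w (kappa_class G A)"
    unfolding starts_vw_def by blast
qed

lemma admissible_exists:
  assumes "A \<in> rooted G v"
  shows "\<exists>p. admissible G v w (kappa_class G A) p"
proof -
  obtain r where "v # r \<in> permutations_of_set (verts G)" "orient G (v # r) = A"
    using orient_source_first[OF simple rootedD(1,2)[OF assms]] by metis
  moreover have "A \<in> kappa_class G A"
    using rootedD(1)[OF assms] kappa_iff[OF simple] gradient_refl unfolding kappa_class_def by blast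
  ultimately have "v # r \<in> permutations_of_set (verts G) \<and> hd (v # r) = v \<and>
      orient G (v # r) \<in> kappa_class G A"
    by simp
  then show ?thesis
    unfolding admissible_def by (intro exI) (rule is_arg_min_arg_min_nat)
qed

text \<open>Some competing order has \<open>w\<close> at position 1, so minimality allows at most 1,
  and position 0 is taken by \<open>v\<close>.\<close>

lemma admissible_starts_vw:
  assumes "admissible G v w C p" "starts_vw G v w C"
  shows "p = v # w # drop 2 p"
proof -
  obtain r where r: "v # w # r \<in> permutations_of_set (verts G)" "orient G (v # w # r) \<in> C"
    using assms(2) unfolding starts_vw_def by blast
  have p: "p \<in> permutations_of_set (verts G)" "hd p = v"
    "\<not> position (v # w # r) w < position p w"
    using assms(1) r unfolding admissible_def is_arg_min_def by auto
  have "w \<in> set p" "p \<noteq> []" using p(1) ends by (auto simp: permutations_of_set_def)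
  then obtain q where q: "p = v # q" using p(2) by (cases p) auto
  have wq: "w \<in> set q" using \<open>w \<in> set p\<close> q ends(3) by auto
  have "position q w = 0"
    using p(3) ends(3) wq unfolding q by (simp add: position_Cons)
  then have "q ! 0 = w" "0 < length q" using nth_position[OF wq] by auto
  then have "q = w # drop 1 q" by (cases q) auto
  then show ?thesis using q by (metis One_nat_def drop_Suc_Cons numeral_2_eq_2)
qed

text \<open>The right-hand side does not mention \<open>p\<close>, so the value is independent of
  the admissible order. Both \<open>A\<close> and \<open>orient G p\<close> contain
  \<open>(v, w)\<close>, so their potential passes to either smaller graph.\<close>

lemma Theta_value_rooted:
  assumes "A \<in> rooted G v" "admissible G v w (kappa_class G A) p"
  shows "Theta_value G v w (kappa_class G A) p = rooted_map A"
proof -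
  have p: "p \<in> permutations_of_set (verts G)" "hd p = v" "orient G p \<in> kappa_class G A"
    using assms(2) unfolding admissible_def is_arg_min_def by auto
  obtain c where c: "orient G p \<in> Acyc G" "gradient G c A (orient G p)"
    using kappa_class_gradient[OF p(3)] by blast
  have A: "A \<in> Acyc G" using rootedD(1)[OF assms(1)] .
  have arcs: "(v, w) \<in> A" "(v, w) \<in> orient G p"
    using source_arc A rootedD(2)[OF assms(1)] c(1) source_hd[OF p(1,2)] by auto
  show ?thesis
  proof (cases "\<forall>x. (x, w) \<in> A \<longrightarrow> x = v")
    case True
    then have starts: "starts_vw G v w (kappa_class G A)"
      using starts_vw_iff[OF assms(1)] by blast
    define s where "s = drop 2 p"
    have s: "p = v # w # s" using admissible_starts_vw[OF assms(2) starts] unfolding s_def .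
    \<comment> \<open>\<open>A\<close> is itself written through an order starting with
      \<open>v\<close>, \<open>w\<close>, the form in which contraction and potentials were
      compared.\<close>
    obtain r where r: "v # w # r \<in> permutations_of_set (verts G)" "orient G (v # w # r) = A"
      using orient_sources_first[OF simple A rootedD(2)[OF assms(1)] ends(2) ends(3)[symmetric]] True
      by metis
    have perm: "v # w # s \<in> permutations_of_set (verts G)" using p(1) s by simp
    have "gradient G_con c (orient G_con (v # r)) (orient G_con (v # s))"
      using con_gradient[OF r(1) perm] c(2) gradient_ends[OF arcs c(2)]
      unfolding r(2) s[symmetric] contract_orient[OF r(1), unfolded r(2)]
        contract_orient[OF perm, folded s] by blast
    then have "kappa_class G_con (orient G_con (v # r)) = kappa_class G_con (orient G_con (v # s))"
      using kappa_class_eq_iff[OF con_simple] orient_Acyc[OF con_simple] r(1) perm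
        con_permutations_iff by metis
    then show ?thesis
      using True starts assms(1) contract_orient[OF r(1)] r(2)
      unfolding Theta_value_def rooted_map_def s_def by simp
  next
    case False
    then have "\<not> starts_vw G v w (kappa_class G A)"
      using starts_vw_iff[OF assms(1)] by blast
    moreover have "kappa_class G_del (A - {(v, w)}) = kappa_class G_del (orient G p - {(v, w)})"
      using kappa_class_eq_iff[OF del_simple del_Acyc[OF A arcs(1)] del_Acyc[OF c(1) arcs(2)]]
        del_gradient[OF c(2)] by blast
    ultimately show ?thesis
      using False del_orient[OF arcs(2)] unfolding Theta_value_def rooted_map_def by simp
  qed
qed

lemma Theta_rooted:
  assumes "A \<in> rooted G v"
  shows "Theta G v w (kappa_class G A) = rooted_map A"
  unfolding Theta_def
  using Theta_value_rooted[OF assms] someI_ex[OF admissible_exists[OF assms]] by blast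

end

theorem theorem3p12:
  fixes G :: "nat graph" and n v w :: nat
  assumes "verts G = {1..n}"
    and "simple_graph G"
    and "connected_graph G"
    and "cycle_edge G {v, w}"
  shows "(\<forall>C \<in> Acyc G // kappa G.
            (\<exists>p. admissible G v w C p) \<and>
            (\<forall>p. admissible G v w C p \<longrightarrow> Theta G v w C = Theta_value G v w C p)) \<and>
         bij_betw (Theta G v w) (Acyc G // kappa G)
           ((Acyc (delete_edge G {v, w}) // kappa (delete_edge G {v, w})) <+>
            (Acyc (contract_edge G v w) // kappa (contract_edge G v w)))"
proof -
  interpret graph_with_edge G v w
    using assms(2,4) by unfold_locales (auto simp: cycle_edge_def)
  have classes: "bij_betw (kappa_class G) (rooted G v) (Acyc G // kappa G)"
    using kappa_class_rooted_bij[OF assms(2,3) ends(1)] .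
  \<comment> \<open>On representatives this composition is \<open>rooted_map\<close>; cancelling the
    bijection \<open>kappa_class G\<close> then leaves \<open>Theta\<close>.\<close>
  have "bij_betw (Theta G v w \<circ> kappa_class G) (rooted G v)
      ((Acyc G_del // kappa G_del) <+> (Acyc G_con // kappa G_con))"
    using rooted_map_bij[OF assms(3,4)] bij_betw_cong[of "rooted G v" rooted_map] Theta_rooted
    by (metis comp_apply)
  then have "bij_betw (Theta G v w) (Acyc G // kappa G)
      ((Acyc G_del // kappa G_del) <+> (Acyc G_con // kappa G_con))"
    using bij_betw_comp_iff[OF classes] by blast
  moreover have "(\<exists>p. admissible G v w C p) \<and>
      (\<forall>p. admissible G v w C p \<longrightarrow> Theta G v w C = Theta_value G v w C p)"
    if C: "C \<in> Acyc G // kappa G" for C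
  proof -
    obtain A where "A \<in> rooted G v" "C = kappa_class G A"
      using C bij_betw_imp_surj_on[OF classes] by blast
    then show ?thesis using admissible_exists Theta_rooted Theta_value_rooted by simp
  qed
  ultimately show ?thesis by blast
qed

end
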